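(* For every integer $k \ge 2$ there exists a Liouville number $\alpha \in [0,1]$ that is normal to the base $k$.
   Context: A real number $\alpha$ in the unit interval is a Liouville number if for every positive integer $n$ there are integers $p>0$ and $q>1$ such that $0<\left|\alpha-\frac{p}{q}\right|<\frac{1}{q^n}$. For an integer base $k\ge 2$, a real number $\alpha\in[0,1]$ is normal to the base $k$ if, writing its base-$k$ expansion as $0.x_0x_1x_2\dots$ with $x_i \in \{0,\dots,k-1\}$, for every $m\ge 1$ and every string $w\in\{0,\dots,k-1\}^m$, the number of indices $i$ with $0\le i\le j-m$ and $x_i x_{i+1}\cdots x_{i+m-1}=w$, divided by $j$, tends to $k^{-m}$ as $j\to\infty$. *)

theory Defs
  imports "HOL-Analysis.Analysis"
begin

definition liouville_number :: "real \<Rightarrow> bool" where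
  "liouville_number \<alpha> \<longleftrightarrow>
     \<alpha> \<in> {0..1} \<and>
     (\<forall>n::nat. n \<ge> 1 \<longrightarrow>
       (\<exists>p q :: int. p > 0 \<and> q > 1 \<and>
          0 < \<bar>\<alpha> - of_int p / of_int q\<bar> \<and>
          \<bar>\<alpha> - of_int p / of_int q\<bar> < 1 / of_int q ^ n))"

text \<open>The digit of index 0 is the first one after the point.\<close>

definition base_expansion :: "nat \<Rightarrow> real \<Rightarrow> (nat \<Rightarrow> nat) \<Rightarrow> bool" where
  "base_expansion k \<alpha> x \<longleftrightarrow>
     (\<forall>i. x i < k) \<and> (\<lambda>i. real (x i) / real k ^ (i + 1)) sums \<alpha>"

text \<open>Number of (possibly overlapping) occurrences of \<open>w\<close> inside
  \<open>x 0, \<dots>, x (j - 1)\<close>. Writing \<open>i + length w \<le> j\<close> rather than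
  \<open>i \<le> j - length w\<close> avoids truncated subtraction.\<close>

definition occurrences :: "(nat \<Rightarrow> nat) \<Rightarrow> nat list \<Rightarrow> nat \<Rightarrow> nat" where
  "occurrences x w j =
     card {i. i + length w \<le> j \<and> map x [i..<i + length w] = w}"

text \<open>A \<open>k\<close>-adic rational may have two expansions, one ending in zeros and one
  ending in digits \<open>k - 1\<close>. Neither has the required frequencies when \<open>k \<ge> 2\<close>,
  so it does not matter which of them is meant by ``the'' expansion.\<close>

definition normal_to_base :: "nat \<Rightarrow> real \<Rightarrow> bool" where
  "normal_to_base k \<alpha> \<longleftrightarrow>
     (\<exists>x. base_expansion k \<alpha> x \<and>
       (\<forall>m\<ge>1. \<forall>w. length w = m \<and> set w \<subseteq> {0..<k} \<longrightarrow>
          (\<lambda>j. real (occurrences x w j) / real j) \<longlonglongrightarrow> 1 / real k ^ m))"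

end

theory Submission
  imports Defs
begin

text \<open>In stage \<open>n\<close> the digits run periodically through a list of all words of length \<open>n\<close>.
  One period contains every word of length \<open>m \<le> n\<close> with nearly the right frequency, the error
  coming only from positions where the word straddles two blocks of length \<open>n\<close>. Each stage is much
  longer than everything before it and than the periods of its own and the next stage, so the
  discrepancy is negligible also inside a stage; and continuing the period of stage \<open>n\<close> forever
  gives a rational number that is extremely close compared with its denominator. The limit is
  irrational because it is normal.\<close>

section \<open>Expansions\<close>

lemma summable_base_expansion:
  fixes x :: "nat \<Rightarrow> nat"
  assumes "k \<ge> 2" "\<And>i. x i < k"
  shows "summable (\<lambda>i. real (x i) / real k ^ (i + 1))"
proof (rule summable_comparison_test')
  show "summable (\<lambda>i. (1 / real k) ^ i)"
    using assms(1) by (intro summable_geometric) auto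
  fix i :: nat
  have "real (x i) \<le> real k"
    using assms(2)[of i] by simp
  then show "norm (real (x i) / real k ^ (i + 1)) \<le> (1 / real k) ^ i"
    using assms(1) by (simp add: field_simps power_one_over)
qed

lemma base_expansion_unit_interval:
  assumes "k \<ge> 2" "base_expansion k \<alpha> x"
  shows "\<alpha> \<in> {0..1}"
proof -
  have lt: "\<And>i. x i < k" and s: "(\<lambda>i. real (x i) / real k ^ (i + 1)) sums \<alpha>"
    using assms(2) by (auto simp: base_expansion_def)
  have "(\<lambda>i. (real k - 1) / real k * (1 / real k) ^ i) sums
          ((real k - 1) / real k * (1 / (1 - 1 / real k)))"
    using assms(1) by (intro sums_mult geometric_sums) auto
  moreover have "(real k - 1) / real k * (1 / (1 - 1 / real k)) = 1"
    using assms(1) by (simp add: field_simps)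
  ultimately have g: "(\<lambda>i. (real k - 1) / real k * (1 / real k) ^ i) sums 1"
    by metis
  have "real (x i) / real k ^ (i + 1) \<le> (real k - 1) / real k * (1 / real k) ^ i" for i
  proof -
    have "real (x i) \<le> real k - 1"
      using lt[of i] by linarith
    then show ?thesis
      using assms(1) by (simp add: field_simps power_one_over)
  qed
  then have "\<alpha> \<le> 1"
    using sums_le[OF _ s g] by blast
  moreover have "0 \<le> \<alpha>"
    using sums_le[OF _ sums_zero s] by simp
  ultimately show ?thesis by simp
qed

lemma base_expansion_shift:
  assumes "k \<ge> 2" "base_expansion k \<alpha> x"
  shows "base_expansion k (real k * \<alpha> - real (x 0)) (\<lambda>i. x (Suc i))"
proof -
  have s: "(\<lambda>i. real (x i) / real k ^ (i + 1)) sums \<alpha>"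
    using assms(2) by (auto simp: base_expansion_def)
  have "(\<lambda>i. real k * (real (x (Suc i)) / real k ^ (Suc i + 1))) sums
          (real k * (\<alpha> - real (x 0) / real k ^ (0 + 1)))"
    using s sums_Suc_iff[of "\<lambda>i. real (x i) / real k ^ (i + 1)"] by (intro sums_mult) simp
  moreover have "(\<lambda>i. real k * (real (x (Suc i)) / real k ^ (Suc i + 1))) =
      (\<lambda>i. real (x (Suc i)) / real k ^ (i + 1))"
    using assms(1) by (auto simp: field_simps)
  moreover have "real k * (\<alpha> - real (x 0) / real k ^ (0 + 1)) = real k * \<alpha> - real (x 0)"
    using assms(1) by (simp add: field_simps)
  ultimately show ?thesis
    using assms(2) by (simp add: base_expansion_def)
qed

text \<open>Multiplying by \<open>k ^ i\<close> moves the first \<open>i\<close> digits in front of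
  the point, where they form the integer \<open>z\<close>. These integers later supply the
  numerators of rational approximations.\<close>

lemma base_expansion_tail:
  assumes "k \<ge> 2" "base_expansion k \<alpha> x"
  obtains z :: int where "base_expansion k (real k ^ i * \<alpha> - of_int z) (\<lambda>j. x (i + j))"
proof -
  have "\<exists>z::int. base_expansion k (real k ^ i * \<alpha> - of_int z) (\<lambda>j. x (i + j))"
  proof (induction i)
    case 0
    show ?case using assms(2) by (intro exI[of _ 0]) simp
  next
    case (Suc i)
    then obtain z :: int where "base_expansion k (real k ^ i * \<alpha> - of_int z) (\<lambda>j. x (i + j))"
      by blast
    from base_expansion_shift[OF assms(1) this] show ?case
      by (intro exI[of _ "int k * z + int (x i)"]) (simp add: algebra_simps)
  qed
  with that show thesis by blast
qed

text \<open>With no common digit the bound says that both numbers lie in the unit interval. Shifting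
  both expansions cancels a common first digit and multiplies the distance by
  \<open>k\<close>.\<close>

lemma base_expansion_common_prefix:
  assumes "k \<ge> 2" "base_expansion k \<alpha> x" "base_expansion k \<beta> y" "\<And>i. i < M \<Longrightarrow> x i = y i"
  shows "\<bar>\<alpha> - \<beta>\<bar> \<le> 1 / real k ^ M"
  using assms(2-4)
proof (induction M arbitrary: \<alpha> \<beta> x y)
  case 0
  then show ?case
    using base_expansion_unit_interval[OF assms(1) 0(1)] base_expansion_unit_interval[OF assms(1) 0(2)]
    by (auto simp: abs_le_iff)
next
  case (Suc M)
  have "\<bar>(real k * \<alpha> - real (x 0)) - (real k * \<beta> - real (y 0))\<bar> \<le> 1 / real k ^ M"
    using Suc.prems(3) by (intro Suc.IH[OF base_expansion_shift base_expansion_shift] assms(1) Suc.prems) auto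
  moreover have "(real k * \<alpha> - real (x 0)) - (real k * \<beta> - real (y 0)) = real k * (\<alpha> - \<beta>)"
    using Suc.prems(3)[of 0] by (simp add: algebra_simps)
  ultimately have "real k * \<bar>\<alpha> - \<beta>\<bar> \<le> 1 / real k ^ M"
    by (simp add: abs_mult)
  then show ?case
    using assms(1) by (simp add: field_simps)
qed

lemma base_expansion_digit_le:
  assumes "k \<ge> 2" "base_expansion k \<alpha> x"
  shows "real (x i) / real k ^ (i + 1) \<le> \<alpha>"
proof -
  have s: "(\<lambda>i. real (x i) / real k ^ (i + 1)) sums \<alpha>"
    using assms(2) by (auto simp: base_expansion_def)
  have "sum (\<lambda>i. real (x i) / real k ^ (i + 1)) {i} \<le> suminf (\<lambda>i. real (x i) / real k ^ (i + 1))"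
    using s by (intro sum_le_suminf) (auto simp: sums_iff)
  then show ?thesis
    using s by (simp add: sums_iff)
qed

text \<open>If \<open>b\<alpha>\<close> is an integer, so is \<open>b\<close> times every tail of the expansion; but the tail at an
  occurrence of \<open>0\<dots>01\<close> is positive and too small for that.\<close>

lemma normal_irrational:
  assumes k: "k \<ge> 2" and "normal_to_base k \<alpha>"
  shows "\<alpha> \<notin> \<rat>"
proof
  assume "\<alpha> \<in> \<rat>"
  then obtain a b :: int where b: "b > 0" and \<alpha>: "\<alpha> = of_int a / of_int b"
    by (elim Rats_cases') auto
  obtain x where x: "base_expansion k \<alpha> x" and
    norm: "\<And>m w. m \<ge> 1 \<Longrightarrow> length w = m \<Longrightarrow> set w \<subseteq> {0..<k} \<Longrightarrow>
        (\<lambda>j. real (occurrences x w j) / real j) \<longlonglongrightarrow> 1 / real k ^ m"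
    using assms(2) by (auto simp: normal_to_base_def)
  \<comment> \<open>Enough zeros that a tail beginning with them is at most
    \<open>1 / k ^ m\<close>, hence below \<open>1 / b\<close>.\<close>
  obtain m where m: "of_int b < real k ^ m"
    using k real_arch_pow[of "real k" "of_int b"] by auto
  define w where "w = replicate m 0 @ [1::nat]"
  have "(\<lambda>j. real (occurrences x w j) / real j) \<longlonglongrightarrow> 1 / real k ^ (m + 1)"
    using k by (intro norm) (auto simp: w_def)
  \<comment> \<open>A positive limit frequency forces at least one occurrence of
    \<open>w\<close>.\<close>
  then have "\<forall>\<^sub>F j in sequentially. real (occurrences x w j) / real j > 0"
    using k by (intro order_tendstoD(1)) auto
  then obtain j where "real (occurrences x w j) / real j > 0"
    using eventually_happens'[OF sequentially_bot] by blast
  then have "occurrences x w j \<noteq> 0"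
    by (intro notI) simp
  then obtain i where "map x [i..<i + length w] = w"
    unfolding occurrences_def by (metis (mono_tags, lifting) card.empty Collect_empty_eq)
  then have "map x [i..<i + length w] ! l = w ! l" for l
    by simp
  moreover have "map x [i..<i + length w] ! l = x (i + l)" if "l < length w" for l
    using that by (subst nth_map) auto
  ultimately have i: "x (i + l) = w ! l" if "l < m + 1" for l
    using that by (simp add: w_def)
  obtain z :: int where z: "base_expansion k (real k ^ i * \<alpha> - of_int z) (\<lambda>j. x (i + j))"
    using base_expansion_tail[OF k x] by blast
  define t where "t = real k ^ i * \<alpha> - of_int z"
  have "base_expansion k 0 (\<lambda>_. 0)"
    using k by (simp add: base_expansion_def)
  then have "\<bar>t - 0\<bar> \<le> 1 / real k ^ m"
    unfolding t_def
    by (rule base_expansion_common_prefix[OF k z]) (simp add: i w_def nth_append)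
  also have "\<dots> < 1 / of_int b"
    using k m b by (intro divide_strict_left_mono mult_pos_pos) auto
  finally have up: "of_int b * t < 1"
    using b by (simp add: field_simps abs_less_iff)
  have "0 < real (x (i + m)) / real k ^ (m + 1)"
    using k by (simp add: i w_def nth_append)
  also have "\<dots> \<le> t"
    unfolding t_def by (rule base_expansion_digit_le[OF k z])
  finally have "0 < of_int b * t"
    using b by simp
  moreover have "of_int b * t = of_int (int k ^ i * a - b * z)"
    using b by (simp add: t_def \<alpha> field_simps)
  ultimately have "0 < int k ^ i * a - b * z" "int k ^ i * a - b * z < 1"
    using up by (metis of_int_0_less_iff, metis of_int_less_1_iff)
  then show False by linarith
qed

section \<open>Criteria for Liouville numbers\<close>

text \<open>Irrationality makes every distance nonzero. Positivity of the numerator comes from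
  approximating with a larger exponent: once the error is below \<alpha>, the fraction must be
  positive.\<close>

lemma liouville_numberI:
  assumes "\<alpha> \<in> {0..1}" "\<alpha> \<notin> \<rat>"
    and approx: "\<And>n. \<exists>p q :: int. q > 1 \<and> \<bar>\<alpha> - of_int p / of_int q\<bar> < 1 / of_int q ^ n"
  shows "liouville_number \<alpha>"
  unfolding liouville_number_def
proof (intro conjI allI impI)
  show "\<alpha> \<in> {0..1}" by fact
  fix n :: nat
  have "\<alpha> > 0"
    using assms(1,2) by (cases "\<alpha> = 0") auto
  \<comment> \<open>Since \<open>q \<ge> 2\<close>, an error below \<open>1 / q ^ N0\<close> is
    below \<alpha>, whatever \<open>q\<close> turns out to be.\<close>
  then obtain N0 where N0: "(1 / 2) ^ N0 < \<alpha>"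
    using real_arch_pow_inv[of \<alpha> "1/2"] by auto
  define N where "N = max n N0"
  obtain p q :: int where q: "q > 1" and pq: "\<bar>\<alpha> - of_int p / of_int q\<bar> < 1 / of_int q ^ N"
    using approx[of N] by blast
  have le: "1 / real_of_int q ^ N \<le> 1 / of_int q ^ M" if "M \<le> N" for M
    using q that by (intro divide_left_mono power_increasing) auto
  have "1 / real_of_int q ^ N0 \<le> 1 / 2 ^ N0"
    using q by (intro divide_left_mono power_mono) auto
  also have "\<dots> < \<alpha>"
    using N0 by (simp add: power_one_over)
  finally have "1 / real_of_int q ^ N < \<alpha>"
    using le[of N0] by (simp add: N_def)
  with pq have "0 < real_of_int p / of_int q"
    by linarith
  then have "p > 0"
    using q by (simp add: zero_less_divide_iff)
  moreover have "0 < \<bar>\<alpha> - of_int p / of_int q\<bar>"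
    using assms(2) by auto
  moreover have "\<bar>\<alpha> - of_int p / of_int q\<bar> < 1 / of_int q ^ n"
    using pq le[of n] by (simp add: N_def)
  ultimately show "\<exists>p q :: int. p > 0 \<and> q > 1 \<and> 0 < \<bar>\<alpha> - of_int p / of_int q\<bar> \<and>
          \<bar>\<alpha> - of_int p / of_int q\<bar> < 1 / of_int q ^ n"
    using q by blast
qed

text \<open>The tails at \<open>s\<close> and \<open>s + L\<close> share \<open>n * (s + L)\<close>
  digits, and their difference is \<open>q * \<alpha> - p\<close> with
  \<open>q = k ^ s * (k ^ L - 1)\<close>, a denominator of any number whose expansion has preperiod
  \<open>s\<close> and period \<open>L\<close>. As \<open>q < k ^ (s + L)\<close>, the shared prefix
  is long enough for exponent \<open>n\<close>. The bound \<open>s + L \<ge> 2\<close> excludes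
  \<open>s = 0\<close>, \<open>L = 1\<close>, where \<open>q\<close> would be 1 for
  \<open>k = 2\<close>.\<close>

lemma approximation_of_periodic_stretch:
  assumes k: "k \<ge> 2" and x: "base_expansion k \<alpha> x" and "L \<ge> 1" "s + L \<ge> 2"
    and per: "\<And>i. i < n * (s + L) \<Longrightarrow> x (s + L + i) = x (s + i)"
  shows "\<exists>p q :: int. q > 1 \<and> \<bar>\<alpha> - of_int p / of_int q\<bar> < 1 / of_int q ^ n"
proof -
  obtain z where z: "base_expansion k (real k ^ s * \<alpha> - of_int z) (\<lambda>j. x (s + j))"
    using base_expansion_tail[OF k x] by blast
  obtain z' where z': "base_expansion k (real k ^ (s + L) * \<alpha> - of_int z') (\<lambda>j. x (s + L + j))"
    using base_expansion_tail[OF k x] by blast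
  define q where "q = int k ^ s * (int k ^ L - 1)"
  \<comment> \<open>For \<open>q > 1\<close>: if \<open>s \<ge> 1\<close> the first factor is at
    least 2; otherwise \<open>L \<ge> 2\<close> and the second is at least 3.\<close>
  have "2 ^ L \<le> int k ^ L" "2 ^ s \<le> int k ^ s"
    using k by (auto intro: power_mono)
  moreover have "1 * 3 \<le> int k ^ s * (int k ^ L - 1)" if "L \<ge> 2"
  proof (intro mult_mono)
    have "(2::int) ^ 2 \<le> 2 ^ L" using that by (intro power_increasing) auto
    then show "3 \<le> int k ^ L - 1"
      using \<open>2 ^ L \<le> int k ^ L\<close> by simp
  qed (use k in auto)
  moreover have "2 * 1 \<le> int k ^ s * (int k ^ L - 1)" if "s \<ge> 1"
  proof (intro mult_mono)
    have "(2::int) ^ 1 \<le> 2 ^ s" using that by (intro power_increasing) auto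
    then show "2 \<le> int k ^ s"
      using \<open>2 ^ s \<le> int k ^ s\<close> by simp
    have "(2::int) ^ 1 \<le> 2 ^ L" using \<open>L \<ge> 1\<close> by (intro power_increasing) auto
    then show "1 \<le> int k ^ L - 1"
      using \<open>2 ^ L \<le> int k ^ L\<close> by simp
  qed auto
  ultimately have q: "q > 1"
    using \<open>s + L \<ge> 2\<close> unfolding q_def by (cases "s \<ge> 1") auto
  have qr: "real_of_int q = real k ^ (s + L) - real k ^ s"
    by (simp add: q_def power_add algebra_simps)
  have qk: "real_of_int q < real k ^ (s + L)"
    unfolding qr using k by simp
  define p where "p = z' - z"
  have "\<bar>(real k ^ (s + L) * \<alpha> - of_int z') - (real k ^ s * \<alpha> - of_int z)\<bar>
          \<le> 1 / real k ^ (n * (s + L))"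
    by (rule base_expansion_common_prefix[OF k z' z per])
  also have "(real k ^ (s + L) * \<alpha> - of_int z') - (real k ^ s * \<alpha> - of_int z) = of_int q * \<alpha> - of_int p"
    by (simp add: qr p_def algebra_simps)
  also have "1 / real k ^ (n * (s + L)) = 1 / (real k ^ (s + L)) ^ n"
    by (metis mult.commute power_mult)
  also have "\<dots> \<le> 1 / of_int q ^ n"
    using q qk by (intro divide_left_mono power_mono) (use k in auto)
  finally have e: "\<bar>of_int q * \<alpha> - of_int p\<bar> \<le> 1 / of_int q ^ n" .
  have "\<bar>\<alpha> - of_int p / of_int q\<bar> = \<bar>of_int q * \<alpha> - of_int p\<bar> / of_int q"
  proof -
    have "\<alpha> - of_int p / of_int q = (of_int q * \<alpha> - of_int p) / of_int q"
      using q by (simp add: field_simps)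
    then show ?thesis
      using q by (simp add: abs_divide)
  qed
  \<comment> \<open>The extra division by \<open>q > 1\<close> makes the final bound strict.\<close>
  also have "\<dots> \<le> 1 / of_int q ^ n / of_int q"
    using q by (intro divide_right_mono e) auto
  also have "\<dots> < 1 / of_int q ^ n / 1"
    using q by (intro divide_strict_left_mono) auto
  finally show ?thesis
    using q by auto
qed

section \<open>Listing all words of a given length\<close>

text \<open>The \<open>t\<close>-th block of length \<open>n\<close> consists of the \<open>n\<close> least significant base-\<open>k\<close> digits
  of \<open>t\<close>, least significant first; hence every \<open>k\<^sup>n\<close> consecutive blocks contain each word of
  length \<open>n\<close> once, and the sequence has period \<open>n k\<^sup>n\<close>.\<close>

definition listing :: "nat \<Rightarrow> nat \<Rightarrow> nat \<Rightarrow> nat" where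
  "listing k n i = i div n div k ^ (i mod n) mod k"

text \<open>The position \<open>r\<close> inside the block is unchanged and the block number grows
  by \<open>c * k ^ n\<close>. Since \<open>r < n\<close>, this is a multiple of
  \<open>k ^ (r + 1)\<close> and leaves digit \<open>r\<close> of the block number alone. For
  \<open>n = 0\<close> or \<open>k = 0\<close> the shift is 0.\<close>

lemma listing_add_period: "listing k n (i + c * (n * k ^ n)) = listing k n i"
proof (cases "n = 0 \<or> k = 0")
  case True
  then show ?thesis by (auto simp: listing_def power_0_left)
next
  case False
  define r where "r = i mod n"
  have "r < n" using False by (simp add: r_def)
  then have "n = r + Suc (n - Suc r)" by simp
  then have "k ^ n = k ^ r * (k * k ^ (n - Suc r))"
    by (metis power_Suc power_add)
  then have eq: "i div n + c * k ^ n = i div n + k ^ r * (k * (c * k ^ (n - Suc r)))"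
    by simp
  have "(i div n + c * k ^ n) div k ^ r = i div n div k ^ r + k * (c * k ^ (n - Suc r))"
    unfolding eq using False by (subst div_mult_self2) auto
  moreover have "(i + c * (n * k ^ n)) div n = i div n + c * k ^ n"
    unfolding mult.left_commute[of c n] using False by (subst div_mult_self2) auto
  moreover have "(i + c * (n * k ^ n)) mod n = r"
    by (simp add: r_def mult.left_commute[of c n])
  ultimately show ?thesis
    by (simp add: listing_def r_def)
qed

section \<open>Deviation from the expected word frequency\<close>

text \<open>Centring turns normality into the claim that partial sums are o(j). Occurrences are
  indexed by their starting position, so a partial sum also sees words that run past its
  end.\<close>

definition deviation :: "nat \<Rightarrow> nat list \<Rightarrow> (nat \<Rightarrow> nat) \<Rightarrow> nat \<Rightarrow> real" where
  "deviation k w x i = of_bool (map x [i..<i + length w] = w) - 1 / real k ^ length w"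

lemma abs_deviation_le_1:
  assumes "k \<ge> 1"
  shows "\<bar>deviation k w x i\<bar> \<le> 1"
proof -
  have "1 \<le> real k ^ length w"
    using assms by (intro one_le_power) auto
  then show ?thesis
    by (auto simp: deviation_def of_bool_def divide_le_eq)
qed

lemma deviation_cong:
  assumes "\<And>l. l < length w \<Longrightarrow> x (i + l) = y (i + l)"
  shows "deviation k w x i = deviation k w y i"
proof -
  have "map x [i..<i + length w] = map y [i..<i + length w]"
    using assms by (intro nth_equalityI) auto
  then show ?thesis by (simp only: deviation_def)
qed

lemma sum_div_blocks:
  fixes h :: "nat \<Rightarrow> real"
  assumes "d > 0"
  shows "(\<Sum>t<A * d. h (t div d)) = real d * (\<Sum>u<A. h u)"
proof -
  have "(\<Sum>t<A * d. h (t div d)) = (\<Sum>u<A. \<Sum>t\<in>{u * d..<u * d + d}. h (t div d))"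
    by (rule sum.nat_group[symmetric])
  also have "\<dots> = (\<Sum>u<A. \<Sum>t\<in>{u * d..<u * d + d}. h u)"
  proof (intro sum.cong refl)
    fix u t assume "t \<in> {u * d..<u * d + d}"
    then have "t div d = u"
      by (intro div_nat_eqI) (auto simp: algebra_simps)
    then show "h (t div d) = h u" by simp
  qed
  finally show ?thesis
    by (simp add: sum_distrib_left)
qed

text \<open>The word fixes the \<open>length w\<close> least significant digits of \<open>u\<close>,
  which leaves one solution for each of the \<open>T\<close> values of the remaining part. The
  induction strips the last digit of \<open>u\<close>, the head of the word: among \<open>k\<close>
  numbers with the same \<open>u div k\<close>, exactly one ends in \<open>a\<close>.\<close>

lemma count_prescribed_digits:
  assumes "set w \<subseteq> {..<k}"
  shows "(\<Sum>u<T * k ^ length w. of_bool (\<forall>l<length w. u div k ^ l mod k = w ! l)) = real T"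
  using assms
proof (induction w arbitrary: T)
  case Nil
  then show ?case by simp
next
  case (Cons a w)
  define P where "P w u \<longleftrightarrow> (\<forall>l<length w. u div k ^ l mod k = w ! l)" for w u
  have a: "a < k" using Cons.prems by simp
  have P: "P (a # w) u \<longleftrightarrow> u mod k = a \<and> P w (u div k)" for u
    by (auto simp: P_def All_less_Suc2 div_mult2_eq)
  have "(\<Sum>u<(T * k ^ length w) * k. of_bool (P (a # w) u)) =
      (\<Sum>v<T * k ^ length w. \<Sum>u\<in>{v * k..<v * k + k}. of_bool (P (a # w) u))"
    by (rule sum.nat_group[symmetric])
  also have "\<dots> = (\<Sum>v<T * k ^ length w. \<Sum>u\<in>{v * k..<v * k + k}. if u = v * k + a then of_bool (P w v) else 0)"
  proof (intro sum.cong refl)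
    fix v u assume u: "u \<in> {v * k..<v * k + k}"
    then have d: "u div k = v"
      by (intro div_nat_eqI) (auto simp: algebra_simps)
    then have "u = v * k + u mod k"
      by (metis div_mult_mod_eq)
    then have "u mod k = a \<longleftrightarrow> u = v * k + a"
      by linarith
    then show "of_bool (P (a # w) u) = (if u = v * k + a then of_bool (P w v) else 0)"
      by (auto simp: P d)
  qed
  also have "\<dots> = (\<Sum>v<T * k ^ length w. of_bool (P w v))"
    using a by (simp add: sum.delta)
  also have "\<dots> = real T"
    unfolding P_def using Cons by simp
  finally show ?case
    by (simp add: P_def mult_ac)
qed

text \<open>At a fixed offset \<open>r\<close> where the word fits into its block, an occurrence
  prescribes the digits \<open>r\<close> to \<open>r + length w - 1\<close> of the block number.
  Over complete cycles of \<open>k ^ n\<close> blocks this has exactly the expected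
  frequency.\<close>

lemma sum_deviation_listing_column:
  assumes k: "k \<ge> 1" and w: "set w \<subseteq> {..<k}" and r: "r + length w \<le> n" "r < n"
  shows "(\<Sum>t<c * k ^ n. deviation k w (listing k n) (t * n + r)) = 0"
proof -
  define m where "m = length w"
  define P where "P u \<longleftrightarrow> (\<forall>l<m. u div k ^ l mod k = w ! l)" for u
  have "map (listing k n) [t * n + r..<t * n + r + m] = w \<longleftrightarrow> P (t div k ^ r)" for t
  proof -
    have "listing k n (t * n + r + l) = t div k ^ r div k ^ l mod k" if "l < m" for l
    proof -
      have rl: "r + l < n"
        using that r by (simp add: m_def)
      have "(t * n + (r + l)) div n = t" "(t * n + (r + l)) mod n = r + l"
        using rl by simp_all
      then have "(t * n + r + l) div n = t" "(t * n + r + l) mod n = r + l"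
        unfolding add.assoc by blast+
      then show ?thesis
        unfolding listing_def by (simp only: power_add div_mult2_eq)
    qed
    then have "map (listing k n) [t * n + r..<t * n + r + m] =
        map (\<lambda>l. t div k ^ r div k ^ l mod k) [0..<m]"
      by (intro nth_equalityI) auto
    moreover have "map h [0..<m] = w \<longleftrightarrow> (\<forall>l<m. h l = w ! l)" for h
      by (subst list_eq_iff_nth_eq) (simp add: m_def)
    ultimately show ?thesis
      unfolding P_def by (simp only:)
  qed
  then have "(\<Sum>t<c * k ^ n. deviation k w (listing k n) (t * n + r)) =
      (\<Sum>t<c * k ^ n. of_bool (P (t div k ^ r)) - 1 / real k ^ m)"
    by (simp add: deviation_def m_def)
  also have "\<dots> = (\<Sum>t<c * k ^ n. of_bool (P (t div k ^ r))) - real (c * k ^ n) / real k ^ m"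
    by (simp add: sum_subtractf)
  also have "\<dots> = 0"
  proof -
    \<comment> \<open>Block numbers split into \<open>r\<close> free low digits, \<open>m\<close>
      prescribed digits, and a high part with \<open>T\<close> possible values.\<close>
    define T where "T = c * k ^ (n - r - m)"
    have "(n - r - m) + m + r = n" using r by (simp add: m_def)
    then have "k ^ (n - r - m) * k ^ m * k ^ r = k ^ n"
      by (simp flip: power_add)
    then have kn: "c * k ^ n = T * k ^ m * k ^ r"
      by (simp add: T_def mult.assoc)
    have "(\<Sum>t<T * k ^ m * k ^ r. of_bool (P (t div k ^ r)) :: real) =
        real (k ^ r) * (\<Sum>u<T * k ^ m. of_bool (P u))"
      using k by (intro sum_div_blocks) auto
    also have "(\<Sum>u<T * k ^ m. of_bool (P u)) = real T"
      unfolding P_def m_def by (rule count_prescribed_digits[OF w])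
    finally show ?thesis
      using k unfolding kn by simp
  qed
  finally show ?thesis .
qed

text \<open>Summed offset by offset, only the at most \<open>length w\<close> offsets where the word
  straddles two blocks contribute, each by at most 1 per block.\<close>

lemma sum_deviation_listing_periods:
  assumes k: "k \<ge> 1" and w: "set w \<subseteq> {..<k}"
  shows "\<bar>\<Sum>i<(c * k ^ n) * n. deviation k w (listing k n) i\<bar> \<le> real (length w) * real (c * k ^ n)"
proof -
  define m where "m = length w"
  define g where "g = deviation k w (listing k n)"
  have "(\<Sum>i<(c * k ^ n) * n. g i) = (\<Sum>t<c * k ^ n. \<Sum>i\<in>{t * n..<t * n + n}. g i)"
    by (rule sum.nat_group[symmetric])
  also have "\<dots> = (\<Sum>t<c * k ^ n. \<Sum>r<n. g (t * n + r))"
  proof (rule sum.cong[OF refl])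
    fix t
    show "(\<Sum>i\<in>{t * n..<t * n + n}. g i) = (\<Sum>r<n. g (t * n + r))"
      by (rule sum.reindex_bij_witness[where i = "\<lambda>r. t * n + r" and j = "\<lambda>i. i - t * n"]) auto
  qed
  also have "\<dots> = (\<Sum>r<n. \<Sum>t<c * k ^ n. g (t * n + r))"
    by (rule sum.swap)
  also have "\<bar>\<dots>\<bar> \<le> (\<Sum>r<n. \<bar>\<Sum>t<c * k ^ n. g (t * n + r)\<bar>)"
    by (rule sum_abs)
  also have "\<dots> \<le> (\<Sum>r<n. if r + m \<le> n then 0 else real (c * k ^ n))"
  proof (intro sum_mono)
    fix r assume "r \<in> {..<n}"
    moreover have "\<bar>\<Sum>t<c * k ^ n. g (t * n + r)\<bar> \<le> (\<Sum>t<c * k ^ n. 1)"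
      unfolding g_def by (intro order_trans[OF sum_abs] sum_mono abs_deviation_le_1 k)
    ultimately show "\<bar>\<Sum>t<c * k ^ n. g (t * n + r)\<bar> \<le> (if r + m \<le> n then 0 else real (c * k ^ n))"
      using sum_deviation_listing_column[OF k w, of r n c] by (simp add: g_def m_def)
  qed
  also have "\<dots> = (\<Sum>r\<in>{r\<in>{..<n}. \<not> r + m \<le> n}. real (c * k ^ n))"
    by (intro sum.mono_neutral_cong_right) auto
  also have "\<dots> = real (card {r\<in>{..<n}. \<not> r + m \<le> n}) * real (c * k ^ n)"
    by simp
  also have "card {r\<in>{..<n}. \<not> r + m \<le> n} \<le> card {n - m..<n}"
    by (intro card_mono) auto
  then have "real (card {r\<in>{..<n}. \<not> r + m \<le> n}) * real (c * k ^ n) \<le> real m * real (c * k ^ n)"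
    by (intro mult_right_mono) auto
  finally show ?thesis
    by (simp add: m_def g_def)
qed

text \<open>The complete periods below \<open>j\<close> consist of at most \<open>j / n\<close>
  blocks, which gives the first term; the incomplete last period is bounded by its length.\<close>

lemma sum_deviation_listing:
  assumes k: "k \<ge> 1" and w: "set w \<subseteq> {..<k}" and n: "n \<ge> 1"
  shows "\<bar>\<Sum>i<j. deviation k w (listing k n) i\<bar> \<le> real (length w) / real n * real j + real (n * k ^ n)"
proof -
  define g where "g = deviation k w (listing k n)"
  define c where "c = j div (k ^ n * n)"
  have j: "j = (c * k ^ n) * n + j mod (k ^ n * n)"
    unfolding c_def mult.assoc by (rule div_mult_mod_eq[symmetric])
  then have le: "(c * k ^ n) * n \<le> j"
    by linarith
  have "(\<Sum>i<j. g i) = (\<Sum>i<(c * k ^ n) * n. g i) + (\<Sum>i\<in>{(c * k ^ n) * n..<j}. g i)"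
    using le by (metis atLeast0LessThan sum.atLeastLessThan_concat zero_le)
  moreover have "\<bar>\<Sum>i<(c * k ^ n) * n. g i\<bar> \<le> real (length w) / real n * real j"
  proof -
    have "\<bar>\<Sum>i<(c * k ^ n) * n. g i\<bar> \<le> real (length w) * real (c * k ^ n)"
      unfolding g_def by (rule sum_deviation_listing_periods[OF k w])
    also have "\<dots> = real (length w) / real n * real ((c * k ^ n) * n)"
      using n by simp
    also have "\<dots> \<le> real (length w) / real n * real j"
      using le by (intro mult_left_mono) (auto simp flip: of_nat_mult)
    finally show ?thesis .
  qed
  moreover have "\<bar>\<Sum>i\<in>{(c * k ^ n) * n..<j}. g i\<bar> \<le> real (n * k ^ n)"
  proof -
    have "\<bar>\<Sum>i\<in>{(c * k ^ n) * n..<j}. g i\<bar> \<le> (\<Sum>i\<in>{(c * k ^ n) * n..<j}. 1)"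
      unfolding g_def by (intro order_trans[OF sum_abs] sum_mono abs_deviation_le_1 k)
    also have "\<dots> = real (j - (c * k ^ n) * n)"
      by simp
    also have "j - (c * k ^ n) * n = j mod (k ^ n * n)"
      using j by linarith
    also have "\<dots> \<le> real (n * k ^ n)"
      using k n by (subst of_nat_le_iff, subst mult.commute) (intro less_imp_le mod_less_divisor, simp)
    finally show ?thesis .
  qed
  ultimately show ?thesis
    by (simp add: g_def)
qed

section \<open>The digits of the normal Liouville number\<close>

fun stage_start :: "nat \<Rightarrow> nat \<Rightarrow> nat" where
  "stage_start k 0 = 0"
| "stage_start k (Suc n) = Suc n * (stage_start k n + Suc n * k ^ Suc n)"

text \<open>The factor \<open>Suc n\<close> makes stage \<open>n\<close> longer than \<open>n\<close> times its start plus one period,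
  which is what the rational approximation of exponent \<open>n\<close> needs. Stage \<open>0\<close> consists of zeros
  by the conventions for division by \<open>0\<close>.\<close>

definition stage :: "nat \<Rightarrow> nat \<Rightarrow> nat" where
  "stage k i = (LEAST n. i < stage_start k (Suc n))"

text \<open>The listing is read at the absolute index, not at the offset within the stage. A sum
  over part of a stage is thus comparable with a difference of two initial sums of one
  listing.\<close>

definition digits :: "nat \<Rightarrow> nat \<Rightarrow> nat" where
  "digits k i = listing k (stage k i) i"

lemma strict_mono_stage_start:
  assumes "k \<ge> 1"
  shows "strict_mono (stage_start k)"
proof (rule strict_monoI_Suc)
  fix n
  have "stage_start k n < 1 * (stage_start k n + Suc n * k ^ Suc n)"
    using assms by simp
  also have "\<dots> \<le> stage_start k (Suc n)"
    unfolding stage_start.simps by (intro mult_right_mono) auto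
  finally show "stage_start k n < stage_start k (Suc n)" .
qed

lemma stage_eqI:
  assumes "k \<ge> 1" "stage_start k n \<le> i" "i < stage_start k (Suc n)"
  shows "stage k i = n"
  unfolding stage_def
proof (rule Least_equality)
  fix n' assume "i < stage_start k (Suc n')"
  then have "stage_start k n < stage_start k (Suc n')"
    using assms by simp
  then show "n \<le> n'"
    using strict_mono_stage_start[OF assms(1)] by (simp add: strict_mono_less del: stage_start.simps)
qed fact

lemma stage_bounds:
  assumes "k \<ge> 1"
  shows "stage_start k (stage k i) \<le> i" "i < stage_start k (Suc (stage k i))"
proof -
  \<comment> \<open>Some stage starts beyond \<open>i\<close>, so the \<open>LEAST\<close> in
    \<open>stage\<close> is attained.\<close>
  have "Suc i \<le> stage_start k (Suc i)"
    using strict_mono_stage_start[OF assms] by (rule strict_mono_imp_increasing)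
  then have ex: "i < stage_start k (Suc i)" by simp
  then show "i < stage_start k (Suc (stage k i))"
    unfolding stage_def by (rule LeastI)
  show "stage_start k (stage k i) \<le> i"
  proof (cases "stage k i")
    case (Suc n)
    then have "n < (LEAST n. i < stage_start k (Suc n))"
      by (simp add: stage_def)
    from not_less_Least[OF this] Suc show ?thesis
      by simp
  qed simp
qed

section \<open>Discrepancy of the constructed digits\<close>

text \<open>Within the stage the digits are those of the listing, so the sum is a difference of two
  initial listing sums, whence the factors 2. The last term covers the starting positions near
  \<open>j\<close> whose word runs past \<open>j\<close>, possibly into the next stage.\<close>

lemma sum_deviation_digits_stage:
  assumes k: "k \<ge> 1" and w: "set w \<subseteq> {..<k}" and n: "n \<ge> 1"
    and j: "stage_start k n \<le> j" "j \<le> stage_start k (Suc n)"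
  shows "\<bar>(\<Sum>i<j. deviation k w (digits k) i) - (\<Sum>i<stage_start k n. deviation k w (digits k) i)\<bar>
    \<le> 2 * real (length w) / real n * real j + 2 * real (n * k ^ n) + real (length w)"
proof -
  define m where "m = length w"
  define s where "s = stage_start k n"
  define f where "f = deviation k w (digits k)"
  define g where "g = deviation k w (listing k n)"
  have split: "(\<Sum>i<j. h i) - (\<Sum>i<s. h i) = (\<Sum>i\<in>{s..<j}. h i)" for h :: "nat \<Rightarrow> real"
    using j(1) sum.atLeastLessThan_concat[of 0 s j h] by (simp add: s_def atLeast0LessThan)
  have G: "\<bar>\<Sum>i<j'. g i\<bar> \<le> real m / real n * real j + real (n * k ^ n)" if "j' \<le> j" for j'
  proof -
    have "real m / real n * real j' \<le> real m / real n * real j"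
      using that by (intro mult_left_mono) auto
    then show ?thesis
      using sum_deviation_listing[OF k w n, of j'] by (simp add: g_def m_def)
  qed
  have "\<bar>\<Sum>i\<in>{s..<j}. f i - g i\<bar> \<le> (\<Sum>i\<in>{s..<j}. \<bar>f i - g i\<bar>)"
    by (rule sum_abs)
  also have "\<dots> \<le> (\<Sum>i\<in>{s..<j}. if i + m \<le> j then 0 else 1)"
  proof (intro sum_mono)
    fix i assume i: "i \<in> {s..<j}"
    have "f i = g i" if "i + m \<le> j"
      unfolding f_def g_def
    proof (rule deviation_cong)
      fix l assume "l < length w"
      then have "stage k (i + l) = n"
        using i j that by (intro stage_eqI k) (auto simp: s_def m_def)
      then show "digits k (i + l) = listing k n (i + l)"
        by (simp add: digits_def)
    qed
    \<comment> \<open>The expected frequency cancels, leaving a difference of two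
      indicators.\<close>
    moreover have "\<bar>f i - g i\<bar> \<le> 1"
      by (auto simp: f_def g_def deviation_def of_bool_def)
    ultimately show "\<bar>f i - g i\<bar> \<le> (if i + m \<le> j then 0 else 1)"
      by simp
  qed
  also have "\<dots> = (\<Sum>i\<in>{i\<in>{s..<j}. \<not> i + m \<le> j}. 1)"
    by (intro sum.mono_neutral_cong_right) auto
  also have "\<dots> = real (card {i\<in>{s..<j}. \<not> i + m \<le> j})"
    by simp
  also have "card {i\<in>{s..<j}. \<not> i + m \<le> j} \<le> card {j - m..<j}"
    by (intro card_mono) auto
  then have "real (card {i\<in>{s..<j}. \<not> i + m \<le> j}) \<le> real m"
    by simp
  finally have "\<bar>(\<Sum>i\<in>{s..<j}. f i) - (\<Sum>i\<in>{s..<j}. g i)\<bar> \<le> real m"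
    by (simp add: sum_subtractf)
  moreover have "\<bar>\<Sum>i<j. g i\<bar> \<le> real m / real n * real j + real (n * k ^ n)"
    "\<bar>\<Sum>i<s. g i\<bar> \<le> real m / real n * real j + real (n * k ^ n)"
    using G j(1) by (auto simp: s_def)
  ultimately have
    "\<bar>\<Sum>i\<in>{s..<j}. f i\<bar> \<le> 2 * (real m / real n * real j) + 2 * real (n * k ^ n) + real m"
    unfolding split[of g, symmetric] by linarith
  then show ?thesis
    unfolding split[of f, symmetric] by (simp add: f_def m_def s_def)
qed

text \<open>Each left-hand side is at most the second factor in the recursion for
  \<open>stage_start k (Suc n)\<close>, and the first factor exceeds \<open>n\<close>.\<close>

lemma stage_start_Suc_ge:
  assumes "k \<ge> 1" "n \<ge> 1"
  shows "real (stage_start k n) \<le> real (stage_start k (Suc n)) / real n"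
    and "real (Suc n * k ^ Suc n) \<le> real (stage_start k (Suc n)) / real n"
    and "real (n * k ^ n) \<le> real (stage_start k (Suc n)) / real n"
    and "1 \<le> real (stage_start k (Suc n)) / real n"
proof -
  define s where "s = stage_start k n"
  have *: "real a \<le> real (stage_start k (Suc n)) / real n" if "a \<le> s + Suc n * k ^ Suc n" for a
  proof -
    have "a * n \<le> (s + Suc n * k ^ Suc n) * Suc n"
      using that by (intro mult_mono) auto
    then have "a * n \<le> stage_start k (Suc n)"
      by (simp add: s_def mult_ac)
    then have "real (a * n) \<le> real (stage_start k (Suc n))"
      by (rule of_nat_mono)
    then show ?thesis
      using assms(2) by (simp add: field_simps del: stage_start.simps)
  qed
  have "n * k ^ n \<le> Suc n * k ^ Suc n"
    using assms by (intro mult_mono power_increasing) auto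
  moreover have "1 * 1 \<le> Suc n * k ^ Suc n"
    using assms by (intro mult_mono one_le_power) auto
  ultimately show "real (stage_start k n) \<le> real (stage_start k (Suc n)) / real n"
    "real (Suc n * k ^ Suc n) \<le> real (stage_start k (Suc n)) / real n"
    "real (n * k ^ n) \<le> real (stage_start k (Suc n)) / real n"
    "1 \<le> real (stage_start k (Suc n)) / real n"
    using *[of s] *[of "Suc n * k ^ Suc n"] *[of "n * k ^ n"] *[of 1]
    by (simp_all add: s_def del: stage_start.simps power_Suc)
qed

text \<open>The range is cut at the starts of stages \<open>n\<close> and \<open>n + 1\<close>. The
  part before stage \<open>n\<close> is short enough for the trivial bound; the whole of stage
  \<open>n\<close> and the begun stage \<open>n + 1\<close> are handled by the estimate inside a
  stage.\<close>

lemma sum_deviation_digits: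
  assumes k: "k \<ge> 1" and w: "set w \<subseteq> {..<k}" and n: "n \<ge> 1" and j: "stage k j = Suc n"
  shows "\<bar>\<Sum>i<j. deviation k w (digits k) i\<bar> \<le> (6 * real (length w) + 5) / real n * real j"
proof -
  define m where "m = real (length w)"
  define F where "F j = (\<Sum>i<j. deviation k w (digits k) i)" for j
  define s where "s = stage_start k (Suc n)"
  have sj: "s \<le> j" "j \<le> stage_start k (Suc (Suc n))"
    using stage_bounds[OF k, of j] unfolding j s_def by auto
  \<comment> \<open>The unit in which all errors are measured. The initial part costs
    \<open>X\<close>; each of the two stages costs \<open>2 * m * X\<close> for straddling words,
    \<open>2 * X\<close> for incomplete periods and \<open>m * X\<close> for words cut at the
    end.\<close>
  define X where "X = real j / real n"
  have X: "real s / real n \<le> X"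
    using sj(1) by (simp add: X_def divide_right_mono)
  note ge = stage_start_Suc_ge[OF k n, folded s_def]
  have m: "0 \<le> m" by (simp add: m_def)
  have mX: "m \<le> m * X"
    using mult_left_mono[of 1 X m] ge(4) X m by simp
  have "\<bar>F (stage_start k n)\<bar> \<le> (\<Sum>i<stage_start k n. 1)"
    unfolding F_def by (intro order_trans[OF sum_abs] sum_mono abs_deviation_le_1 k)
  then have 1: "\<bar>F (stage_start k n)\<bar> \<le> X"
    using ge(1) X by simp
  have "\<bar>F s - F (stage_start k n)\<bar> \<le> 2 * m / real n * real s + 2 * real (n * k ^ n) + m"
    unfolding F_def s_def m_def
    using strict_mono_stage_start[OF k, THEN strict_mono_leD, of n "Suc n"]
    by (intro sum_deviation_digits_stage[OF k w n]) auto
  moreover have "2 * m / real n * real s \<le> 2 * (m * X)"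
    using mult_left_mono[OF X m] by (simp add: mult.assoc)
  ultimately have 2: "\<bar>F s - F (stage_start k n)\<bar> \<le> 3 * (m * X) + 2 * X"
    using ge(3) X mX by linarith
  have "\<bar>F j - F s\<bar> \<le> 2 * m / real (Suc n) * real j + 2 * real (Suc n * k ^ Suc n) + m"
    unfolding F_def s_def m_def
    using sj by (intro sum_deviation_digits_stage[OF k w]) (auto simp: s_def simp del: stage_start.simps)
  moreover have "2 * m / real (Suc n) * real j \<le> 2 * m / real n * real j"
    using n m by (intro mult_right_mono divide_left_mono) auto
  moreover have "2 * m / real n * real j = 2 * (m * X)"
    by (simp add: X_def)
  ultimately have 3: "\<bar>F j - F s\<bar> \<le> 3 * (m * X) + 2 * X"
    using ge(2) X mX by linarith
  have "\<bar>F j\<bar> \<le> 6 * (m * X) + 5 * X"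
    using 1 2 3 by linarith
  also have "\<dots> = (6 * m + 5) / real n * real j"
    by (simp add: X_def add_divide_distrib distrib_right)
  finally show ?thesis
    by (simp add: F_def m_def)
qed

lemma sum_deviation_digits_tendsto:
  assumes k: "k \<ge> 1" and w: "set w \<subseteq> {..<k}"
  shows "(\<lambda>j. (\<Sum>i<j. deviation k w (digits k) i) / real j) \<longlonglongrightarrow> 0"
proof (rule LIMSEQ_I)
  fix e :: real assume e: "e > 0"
  define C where "C = 6 * real (length w) + 5"
  \<comment> \<open>From the start of stage \<open>n0 + 1\<close> on, the relative error is at most
    \<open>C / n0 < e\<close>.\<close>
  obtain n0 where n0: "C / e < real n0"
    using reals_Archimedean2 by blast
  have "C / e > 0" using e by (simp add: C_def add_nonneg_pos)
  then have n0_pos: "n0 \<ge> 1" using n0 by (cases n0) auto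
  show "\<exists>J. \<forall>j\<ge>J. norm ((\<Sum>i<j. deviation k w (digits k) i) / real j - 0) < e"
  proof (intro exI allI impI)
    fix j assume "stage_start k (Suc n0) \<le> j"
    then have "stage_start k (Suc n0) < stage_start k (Suc (stage k j))"
      using stage_bounds(2)[OF k, of j] by linarith
    then have "n0 < stage k j"
      using strict_mono_stage_start[OF k] by (simp add: strict_mono_less del: stage_start.simps)
    then obtain n where n: "stage k j = Suc n" "n0 \<le> n"
      by (cases "stage k j") auto
    have "stage_start k 0 < stage_start k (Suc n)"
      using strict_mono_stage_start[OF k] strict_monoD by blast
    then have j: "j > 0"
      using stage_bounds(1)[OF k, of j] n(1) by (simp del: stage_start.simps(2))
    have "\<bar>\<Sum>i<j. deviation k w (digits k) i\<bar> \<le> C / real n * real j"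
      unfolding C_def using n n0_pos by (intro sum_deviation_digits k w) auto
    also have "\<dots> \<le> C / real n0 * real j"
      using n(2) n0_pos by (intro mult_right_mono divide_left_mono) (auto simp: C_def)
    also have "\<dots> < e * real j"
      using n0 n0_pos e j by (intro mult_strict_right_mono) (auto simp: field_simps)
    finally show "norm ((\<Sum>i<j. deviation k w (digits k) i) / real j - 0) < e"
      using j by (simp add: field_simps)
  qed
qed

section \<open>From deviations to frequencies, and the conclusion\<close>

text \<open>Partial sums count words starting before \<open>j\<close>, while
  \<open>occurrences\<close> counts those ending by \<open>j\<close>. The counts differ by at most
  \<open>length w\<close>, which vanishes after division by \<open>j\<close>.\<close>

lemma frequency_tendsto_of_deviation:
  assumes w: "length w \<ge> 1"
    and dev: "(\<lambda>j. (\<Sum>i<j. deviation k w x i) / real j) \<longlonglongrightarrow> 0"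
  shows "(\<lambda>j. real (occurrences x w j) / real j) \<longlonglongrightarrow> 1 / real k ^ length w"
proof -
  define m where "m = length w"
  define A where "A j = {i. i < j \<and> map x [i..<i + m] = w}" for j
  have dA: "(\<Sum>i<j. deviation k w x i) = real (card (A j)) - real j * (1 / real k ^ m)" for j
  proof -
    have "(\<Sum>i<j. of_bool (map x [i..<i + m] = w)) = real (card (A j))"
      by (simp add: A_def sum_of_bool_eq Int_def)
    then show ?thesis
      by (simp add: deviation_def sum_subtractf m_def)
  qed
  have bound: "\<bar>real (occurrences x w j) - real (card (A j))\<bar> \<le> real m" for j
  proof -
    define B where "B = {i. i + m \<le> j \<and> map x [i..<i + m] = w}"
    have fin: "finite (A j)" by (simp add: A_def)
    \<comment> \<open>For a nonempty word, \<open>i + m \<le> j\<close> implies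
      \<open>i < j\<close>.\<close>
    have BA: "B \<subseteq> A j"
      using w by (auto simp: A_def B_def m_def)
    have fB: "finite B" using BA fin by (rule finite_subset)
    have "A j \<subseteq> B \<union> {j - m..<j}"
      by (auto simp: A_def B_def)
    then have "card (A j) \<le> card (B \<union> {j - m..<j})"
      using fB by (intro card_mono) auto
    also have "\<dots> \<le> card B + card {j - m..<j}"
      by (rule card_Un_le)
    also have "\<dots> \<le> card B + m" by simp
    finally have "card (A j) \<le> card B + m" .
    moreover have "card B \<le> card (A j)"
      using fin BA by (rule card_mono)
    moreover have "occurrences x w j = card B"
      by (simp add: occurrences_def B_def m_def)
    ultimately show ?thesis
      by linarith
  qed
  have "(\<lambda>j. (real (occurrences x w j) - real (card (A j))) / real j) \<longlonglongrightarrow> 0"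
  proof (rule Lim_null_comparison)
    show "(\<lambda>j. real m / real j) \<longlonglongrightarrow> 0"
      by (rule lim_const_over_n)
    show "\<forall>\<^sub>F j in sequentially.
        norm ((real (occurrences x w j) - real (card (A j))) / real j) \<le> real m / real j"
      using bound by (intro always_eventually allI) (simp add: divide_right_mono)
  qed
  from tendsto_add[OF tendsto_add[OF this dev] tendsto_const[of "1 / real k ^ m"]]
  have "(\<lambda>j. (real (occurrences x w j) - real (card (A j))) / real j
      + (\<Sum>i<j. deviation k w x i) / real j + 1 / real k ^ m) \<longlonglongrightarrow> 1 / real k ^ m"
    by simp
  then show ?thesis
    unfolding m_def
  proof (rule Lim_transform_eventually)
    show "\<forall>\<^sub>F j in sequentially. (real (occurrences x w j) - real (card (A j))) / real j
      + (\<Sum>i<j. deviation k w x i) / real j + 1 / real k ^ length w = real (occurrences x w j) / real j"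
      \<comment> \<open>The constant \<open>1 / k ^ m\<close> cancels only after dividing by a
        positive \<open>j\<close>.\<close>
      using eventually_gt_at_top[of 0]
      by eventually_elim (simp add: dA m_def diff_divide_distrib)
  qed
qed

theorem mainTheorem1:
  fixes k :: nat
  assumes "k \<ge> 2"
  shows "\<exists>\<alpha>::real. \<alpha> \<in> {0..1} \<and> liouville_number \<alpha> \<and> normal_to_base k \<alpha>"
proof -
  have k1: "k \<ge> 1" using assms by simp
  define x where "x = digits k"
  have lt: "x i < k" for i
    using assms by (simp add: x_def digits_def listing_def)
  define \<alpha> where "\<alpha> = (\<Sum>i. real (x i) / real k ^ (i + 1))"
  have x: "base_expansion k \<alpha> x"
    unfolding base_expansion_def \<alpha>_def
    using lt summable_base_expansion[OF assms] by (intro conjI allI summable_sums) blast+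
  have "(\<lambda>j. real (occurrences x w j) / real j) \<longlonglongrightarrow> 1 / real k ^ length w"
    if "length w \<ge> 1" "set w \<subseteq> {0..<k}" for w
    unfolding x_def using that
    by (intro frequency_tendsto_of_deviation sum_deviation_digits_tendsto[OF k1]) auto
  then have normal: "normal_to_base k \<alpha>"
    unfolding normal_to_base_def using x by blast
  have unit: "\<alpha> \<in> {0..1}"
    using base_expansion_unit_interval[OF assms x] .
  have "liouville_number \<alpha>"
  proof (rule liouville_numberI)
    show "\<alpha> \<in> {0..1}" by (rule unit)
    show "\<alpha> \<notin> \<rat>" by (rule normal_irrational[OF assms normal])
    fix n :: nat
    \<comment> \<open>Stage 0 is avoided because its period \<open>L\<close> would be 0.\<close>
    define N where "N = max n 1"
    define s where "s = stage_start k N"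
    define L where "L = N * k ^ N"
    have L: "L \<ge> 2"
    proof -
      have "1 * 2 \<le> N * k ^ N"
      proof (intro mult_mono)
        have "k ^ 1 \<le> k ^ N" using assms by (intro power_increasing) (auto simp: N_def)
        then show "2 \<le> k ^ N" using assms by simp
      qed (auto simp: N_def)
      then show ?thesis by (simp add: L_def)
    qed
    have "L \<le> Suc N * k ^ Suc N"
      unfolding L_def using k1 by (intro mult_mono power_increasing) auto
    then have "Suc N * (s + L) \<le> stage_start k (Suc N)"
      unfolding stage_start.simps s_def by (intro mult_left_mono add_left_mono) auto
    moreover have "n * (s + L) \<le> N * (s + L)"
      by (intro mult_right_mono) (auto simp: N_def)
    \<comment> \<open>Stage \<open>N\<close> has room for one period and a further
      \<open>n * (s + L)\<close> digits, so \<open>s + i\<close> and \<open>s + L + i\<close> both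
      lie in it.\<close>
    ultimately have le: "s + L + n * (s + L) \<le> stage_start k (Suc N)"
      unfolding mult_Suc by linarith
    show "\<exists>p q :: int. q > 1 \<and> \<bar>\<alpha> - of_int p / of_int q\<bar> < 1 / of_int q ^ n"
    proof (rule approximation_of_periodic_stretch[OF assms x])
      show "1 \<le> L" "2 \<le> s + L" using L by auto
      fix i assume i: "i < n * (s + L)"
      have "stage k (s + L + i) = N" "stage k (s + i) = N"
        using i le by (auto intro!: stage_eqI[OF k1] simp: s_def simp del: stage_start.simps)
      moreover have "listing k N (s + L + i) = listing k N (s + i)"
        using listing_add_period[of k N "s + i" 1] by (simp add: L_def add_ac)
      ultimately show "x (s + L + i) = x (s + i)"
        by (simp add: x_def digits_def)
    qed
  qed
  with unit normal show ?thesis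
    by blast
qed

end
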